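(* Let $t\ge 4$, $g\ge 1$ and $1\le m<t-1$ be integers. Let $d_{\mathrm{plan}}$ be a uniform balanced repeated measurements design (UBRMD) with $t$ treatments, $t$ time periods and $s=gt$ subjects, and let $d_{\min}$ be the design consisting of the first $t-m$ periods of $d_{\mathrm{plan}}$. Then for $d_{\min}$: (i) the information matrices for the direct and the carry-over treatment effects are $C_D=C_{11}-C_{12}C_{22}^{-}C_{21}$ and $C_R=C_{22}-C_{21}C_{11}^{-}C_{12}$, respectively, with $C_{21}=C_{12}'$ and $$C_{11}=\frac{g[(t-m)^2-m]}{t-m}I_t-\frac{g(t-2m)}{t-m}J_t-\frac{1}{t-m}\sum_{\substack{0\le j,k\le m-1\\ j\ne k}}U_{jk},$$ $$C_{22}=\frac{g}{t-m}\Big[\big((t-m)^2-(t+1)\big)I_t-t^{-1}\big((t-m)^2-(t+1)-m(m+1)\big)J_t\Big]-\frac{1}{t-m}\sum_{\substack{0\le j,k\le m\\ j\ne k}}U_{jk},$$ $$C_{12}=\frac{g}{t-m}\big[(m+1)J_t-tI_t\big]-\sum_{j=0}^{m-1}U_{j(j+1)}-\frac{1}{t-m}\sum_{j=0}^{m-1}\ \sum_{\substack{0\le k\le m\\ k\ne j}}U_{jk};$$ (ii) if $t\ge 2m+2$, then a g-inverse of $C_{22}$ is $C_{22}^{-}=A^{-1}$ (in particular $A$ is invertible), where $$A=\frac{g}{t-m}\big[(t-m)^2-(t+1)\big]I_t-\frac{1}{t-m}\sum_{\substack{0\le j,k\le m\\ j\ne k}}U_{jk}.$$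
   Context: A (crossover) design with $p$ periods, $s$ subjects and $t$ treatments labelled $0,\dots,t-1$ assigns a treatment $d(k,i)$ to each subject $i\in\{1,\dots,s\}$ in each period $k\in\{1,\dots,p\}$. It is uniform if each subject receives every treatment in the same number of periods and in each period every treatment is given to the same number of subjects. It is balanced if, in the order of application, each treatment is immediately preceded by every other treatment the same number of times and is never immediately preceded by itself. A UBRMD with $t$ treatments, $t$ periods and $s=gt$ subjects is a uniform and balanced such design (so each subject receives each treatment exactly once, and each treatment appears $g$ times in each period). Model: $Y=X_S\beta+X_P\alpha+X_D\tau+X_C\rho+\epsilon$, with fixed subject effects $\beta\in\mathbb R^s$, period effects $\alpha\in\mathbb R^p$, direct treatment effects $\tau\in\mathbb R^t$, carry-over effects $\rho\in\mathbb R^t$. Responses are ordered period by period for each subject in turn: $X_S=I_s\otimes \mathbf 1_p$, $X_P=\mathbf 1_s\otimes I_p$. The row of $X_D$ for (subject $i$, period $k$) has a $1$ in the column of treatment $d(k,i)$ and $0$ elsewhere; the row of $X_C$ for $(i,k)$ has a $1$ in the column of treatment $d(k-1,i)$ and $0$ elsewhere if $k\ge2$, and is zero if $k=1$. Put $N_{ab}=X_a'X_b$ for $a,b\in\{S,P,D,C\}$, $r_D=N_{DS}\mathbf 1_s$, $r_C=N_{CS}\mathbf 1_s$, $r_D^\delta=\mathrm{diag}(r_D)$, $r_C^\delta=\mathrm{diag}(r_C)$. The joint information matrix for direct and carry-over effects is $C=\begin{bmatrix}C_{11}&C_{12}\\ C_{21}&C_{22}\end{bmatrix}$ with $C_{11}=r_D^\delta+\frac1{ps}r_Dr_D'-\frac1pN_{DS}N_{SD}-\frac1sN_{DP}N_{PD}$,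 $C_{22}=r_C^\delta+\frac1{ps}r_Cr_C'-\frac1pN_{CS}N_{SC}-\frac1sN_{CP}N_{PC}$, $C_{12}=N_{DC}+\frac1{ps}r_Dr_C'-\frac1pN_{DS}N_{SC}-\frac1sN_{DP}N_{PC}$, $C_{21}=C_{12}'$. For $d_{\min}$ these are computed with $p=t-m$ and $s=gt$. The information matrix for direct effects is $C_D=C_{11}-C_{12}C_{22}^{-}C_{21}$ and that for carry-over effects is $C_R=C_{22}-C_{21}C_{11}^{-}C_{12}$. Here $M^-$ denotes a g-inverse (generalized inverse): $MM^-M=M$. Notation: $'$ is transpose, $\mathbf 1_a$ is the all-ones vector of length $a$, $J_t=\mathbf 1_t\mathbf 1_t'$, $I_t$ is the identity. For $j=1,\dots,t$, $P_j$ is the $t\times s$ matrix whose $(h,i)$ entry is $1$ if subject $i$ receives treatment $h$ in period $j$ of $d_{\mathrm{plan}}$ and $0$ otherwise. For $0\le j,k\le t-1$, $U_{jk}=P_{t-j}P_{t-k}'$ (and $U_{j(j+1)}$ means $U_{jk}$ with $k=j+1$). *)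

theory Defs
  imports Complex_Main "Jordan_Normal_Form.Matrix"
begin

(* Periods and subjects are numbered from 1, treatments from 0;
   "assignment d k i" is the treatment given to subject i in period k.
   Values of "assignment" outside {1..periods} x {1..subjects} are irrelevant. *)
record design =
  periods :: nat
  subjects :: nat
  treatments :: nat
  assignment :: "nat \<Rightarrow> nat \<Rightarrow> nat"

definition crossover_design :: "design \<Rightarrow> bool" where
  "crossover_design d \<longleftrightarrow>
     (\<forall>k\<in>{1..periods d}. \<forall>i\<in>{1..subjects d}. assignment d k i < treatments d)"

definition uniform_design :: "design \<Rightarrow> bool" where
  "uniform_design d \<longleftrightarrow>
     (\<exists>n. \<forall>i\<in>{1..subjects d}. \<forall>a<treatments d.
        card {k\<in>{1..periods d}. assignment d k i = a} = n) \<and>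
     (\<exists>n. \<forall>k\<in>{1..periods d}. \<forall>a<treatments d.
        card {i\<in>{1..subjects d}. assignment d k i = a} = n)"

definition times_preceded :: "design \<Rightarrow> nat \<Rightarrow> nat \<Rightarrow> nat" where
  "times_preceded d a b =
     card {(k, i). k \<in> {2..periods d} \<and> i \<in> {1..subjects d} \<and>
                   assignment d k i = a \<and> assignment d (k - 1) i = b}"

definition balanced_design :: "design \<Rightarrow> bool" where
  "balanced_design d \<longleftrightarrow>
     (\<exists>n. \<forall>a<treatments d. \<forall>b<treatments d. a \<noteq> b \<longrightarrow> times_preceded d a b = n) \<and>
     (\<forall>a<treatments d. times_preceded d a a = 0)"

definition UBRMD :: "nat \<Rightarrow> nat \<Rightarrow> design \<Rightarrow> bool" where
  "UBRMD t g d \<longleftrightarrow>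
     treatments d = t \<and> periods d = t \<and> subjects d = g * t \<and>
     crossover_design d \<and> uniform_design d \<and> balanced_design d"

definition first_periods :: "nat \<Rightarrow> design \<Rightarrow> design" where
  "first_periods q d = d\<lparr>periods := q\<rparr>"


definition kronecker :: "real mat \<Rightarrow> real mat \<Rightarrow> real mat" where
  "kronecker A B =
     mat (dim_row A * dim_row B) (dim_col A * dim_col B)
       (\<lambda>(r, c). A $$ (r div dim_row B, c div dim_col B) * B $$ (r mod dim_row B, c mod dim_col B))"

definition ones :: "nat \<Rightarrow> real mat" where
  "ones n = mat n 1 (\<lambda>_. 1)"

definition J_mat :: "nat \<Rightarrow> real mat" where
  "J_mat n = ones n * (ones n)\<^sup>T"

definition mat_sum :: "nat \<Rightarrow> nat \<Rightarrow> ('a \<Rightarrow> real mat) \<Rightarrow> 'a set \<Rightarrow> real mat" where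
  "mat_sum nr nc F S = mat nr nc (\<lambda>(a, b). \<Sum>x\<in>S. F x $$ (a, b))"

definition g_inverse :: "real mat \<Rightarrow> real mat \<Rightarrow> bool" where
  "g_inverse M G \<longleftrightarrow> G \<in> carrier_mat (dim_col M) (dim_row M) \<and> M * G * M = M"


datatype effect = Subj | Per | Dir | Carry

(* Row r (counted from 0) is the response of subject r div p + 1 in period r mod p + 1. *)
fun X :: "design \<Rightarrow> effect \<Rightarrow> real mat" where
  "X d Subj = kronecker (1\<^sub>m (subjects d)) (ones (periods d))"
| "X d Per = kronecker (ones (subjects d)) (1\<^sub>m (periods d))"
| "X d Dir = mat (subjects d * periods d) (treatments d)
     (\<lambda>(r, h). let i = r div periods d + 1; k = r mod periods d + 1
               in if assignment d k i = h then 1 else 0)"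
| "X d Carry = mat (subjects d * periods d) (treatments d)
     (\<lambda>(r, h). let i = r div periods d + 1; k = r mod periods d + 1
               in if k \<ge> 2 \<and> assignment d (k - 1) i = h then 1 else 0)"

definition N :: "design \<Rightarrow> effect \<Rightarrow> effect \<Rightarrow> real mat" where
  "N d a b = (X d a)\<^sup>T * X d b"

definition rep :: "design \<Rightarrow> effect \<Rightarrow> real mat" where
  "rep d a = N d a Subj * ones (subjects d)"

definition rep_diag :: "design \<Rightarrow> effect \<Rightarrow> real mat" where
  "rep_diag d a = mat_diag (treatments d) (\<lambda>h. rep d a $$ (h, 0))"

definition C11 :: "design \<Rightarrow> real mat" where
  "C11 d = (let p = real (periods d); s = real (subjects d) in
     rep_diag d Dir
     + (1 / (p * s)) \<cdot>\<^sub>m (rep d Dir * (rep d Dir)\<^sup>T)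
     - (1 / p) \<cdot>\<^sub>m (N d Dir Subj * N d Subj Dir)
     - (1 / s) \<cdot>\<^sub>m (N d Dir Per * N d Per Dir))"

definition C22 :: "design \<Rightarrow> real mat" where
  "C22 d = (let p = real (periods d); s = real (subjects d) in
     rep_diag d Carry
     + (1 / (p * s)) \<cdot>\<^sub>m (rep d Carry * (rep d Carry)\<^sup>T)
     - (1 / p) \<cdot>\<^sub>m (N d Carry Subj * N d Subj Carry)
     - (1 / s) \<cdot>\<^sub>m (N d Carry Per * N d Per Carry))"

definition C12 :: "design \<Rightarrow> real mat" where
  "C12 d = (let p = real (periods d); s = real (subjects d) in
     N d Dir Carry
     + (1 / (p * s)) \<cdot>\<^sub>m (rep d Dir * (rep d Carry)\<^sup>T)
     - (1 / p) \<cdot>\<^sub>m (N d Dir Subj * N d Subj Carry)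
     - (1 / s) \<cdot>\<^sub>m (N d Dir Per * N d Per Carry))"

definition C21 :: "design \<Rightarrow> real mat" where
  "C21 d = (C12 d)\<^sup>T"

(* Every real matrix has a g-inverse, so SOME picks a genuine one. *)
definition C_D :: "design \<Rightarrow> real mat" where
  "C_D d = C11 d - C12 d * (SOME G. g_inverse (C22 d) G) * C21 d"

definition C_R :: "design \<Rightarrow> real mat" where
  "C_R d = C22 d - C21 d * (SOME G. g_inverse (C11 d) G) * C12 d"


definition P :: "design \<Rightarrow> nat \<Rightarrow> real mat" where
  "P d j = mat (treatments d) (subjects d)
     (\<lambda>(h, i). if assignment d j (i + 1) = h then 1 else 0)"

definition U :: "design \<Rightarrow> nat \<Rightarrow> nat \<Rightarrow> real mat" where
  "U d j k = P d (treatments d - j) * (P d (treatments d - k))\<^sup>T"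

end

theory Submission
  imports Defs "Jordan_Normal_Form.Determinant"
begin

text \<open>
  Eliminating the subject and period effects amounts to projecting the columns of \<open>X_D\<close> and
  \<open>X_C\<close> by double centring over the subject by period table, so the blocks of the joint
  information matrix are the products \<open>V\<^sub>a' V\<^sub>b\<close> of the centred matrices. For such Gram
  matrices \<open>V G V' V = V\<close> for every g-inverse \<open>G\<close> of \<open>V' V\<close>, which makes \<open>C_D\<close> and \<open>C_R\<close>
  independent of the g-inverse.
  In the full design every subject receives each treatment once, so the counts over the first
  \<open>n\<close> periods are 1 minus the counts over the remaining ones; their products are the matrices
  \<open>U\<^sub>j\<^sub>k\<close>.
  Finally, \<open>A\<close> has all row sums equal to some \<open>\<mu>\<close> and \<open>C22 = A - (\<mu> / t) J\<close>. If
  \<open>t \<ge> 2 m + 2\<close> then \<open>\<mu> > 0\<close>, so \<open>A\<close> is strictly diagonally dominant and \<open>A\<^sup>-\<^sup>1 J = J / \<mu>\<close>,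
  from which \<open>C22 A\<^sup>-\<^sup>1 C22 = C22\<close>.
\<close>

section \<open>Double centring\<close>

text \<open>The residual table left by a least squares fit of additive subject and period effects;
  the last term restores the grand mean, which the other two corrections remove twice.\<close>

definition dbl_center :: "nat \<Rightarrow> nat \<Rightarrow> (nat \<Rightarrow> nat \<Rightarrow> real) \<Rightarrow> nat \<Rightarrow> nat \<Rightarrow> real" where
  "dbl_center s p f i k = f i k - (\<Sum>k<p. f i k) / real p - (\<Sum>i<s. f i k) / real s
     + (\<Sum>i<s. \<Sum>k<p. f i k) / (real p * real s)"

lemma sum_dbl_center_row:
  assumes "s > 0" "p > 0"
  shows "(\<Sum>k<p. dbl_center s p f i k) = 0"
proof -
  have "(\<Sum>k<p. \<Sum>i<s. f i k) = (\<Sum>i<s. \<Sum>k<p. f i k)"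
    by (rule sum.swap)
  then show ?thesis
    using assms by (simp add: dbl_center_def sum.distrib sum_subtractf flip: sum_divide_distrib)
qed

lemma sum_dbl_center_col:
  assumes "s > 0" "p > 0"
  shows "(\<Sum>i<s. dbl_center s p f i k) = 0"
  using assms by (simp add: dbl_center_def sum.distrib sum_subtractf flip: sum_divide_distrib)

text \<open>Centring is a self-adjoint projection, so the second factor need not be centred once the
  first one is. The four terms on the right are those of the entries of the joint information
  matrix.\<close>

lemma sum_dbl_center_mult:
  assumes "s > 0" "p > 0"
  shows "(\<Sum>i<s. \<Sum>k<p. dbl_center s p f i k * dbl_center s p h i k) =
    (\<Sum>i<s. \<Sum>k<p. f i k * h i k)
    + (1 / (real p * real s)) * ((\<Sum>i<s. \<Sum>k<p. f i k) * (\<Sum>i<s. \<Sum>k<p. h i k))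
    - (1 / real p) * (\<Sum>i<s. (\<Sum>k<p. f i k) * (\<Sum>k<p. h i k))
    - (1 / real s) * (\<Sum>k<p. (\<Sum>i<s. f i k) * (\<Sum>i<s. h i k))"
proof -
  let ?F = "dbl_center s p f"
  have R: "(\<Sum>i<s. \<Sum>k<p. ?F i k * c i) = 0" for c
    using assms by (simp add: sum_dbl_center_row flip: sum_distrib_right)
  have C: "(\<Sum>i<s. \<Sum>k<p. ?F i k * c k) = 0" for c
    by (subst sum.swap) (use assms in \<open>simp add: sum_dbl_center_col flip: sum_distrib_right\<close>)
  have "(\<Sum>i<s. \<Sum>k<p. ?F i k * dbl_center s p h i k) =
      (\<Sum>i<s. \<Sum>k<p. ?F i k * h i k)
      - (\<Sum>i<s. \<Sum>k<p. ?F i k * ((\<Sum>k<p. h i k) / real p))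
      - (\<Sum>i<s. \<Sum>k<p. ?F i k * ((\<Sum>i<s. h i k) / real s))
      + (\<Sum>i<s. \<Sum>k<p. ?F i k * ((\<Sum>i<s. \<Sum>k<p. h i k) / (real p * real s)))"
    by (subst (2) dbl_center_def)
      (simp only: ring_distribs sum.distrib sum_subtractf)
  also have "\<dots> = (\<Sum>i<s. \<Sum>k<p. ?F i k * h i k)"
    unfolding R C by simp
  also have "\<dots> = (\<Sum>i<s. \<Sum>k<p. f i k * h i k)
      - (\<Sum>i<s. \<Sum>k<p. (\<Sum>k<p. f i k) / real p * h i k)
      - (\<Sum>i<s. \<Sum>k<p. (\<Sum>i<s. f i k) / real s * h i k)
      + (\<Sum>i<s. \<Sum>k<p. (\<Sum>i<s. \<Sum>k<p. f i k) / (real p * real s) * h i k)"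
    by (subst dbl_center_def) (simp only: ring_distribs sum.distrib sum_subtractf)
  \<comment> \<open>The period mean depends on \<open>k\<close> alone, so it factors out once the
    sum over subjects is innermost.\<close>
  also have "(\<Sum>i<s. \<Sum>k<p. (\<Sum>i<s. f i k) / real s * h i k) =
      (\<Sum>k<p. \<Sum>i<s. (\<Sum>i<s. f i k) / real s * h i k)"
    by (rule sum.swap)
  finally show ?thesis
    by (simp add: sum_distrib_right sum_distrib_left sum_divide_distrib)
qed

section \<open>Information matrices as Gram matrices\<close>

text \<open>Responses are stacked subject by subject in blocks of \<open>p\<close>; this turns sums
  over rows into sums over the subject by period table.\<close>

lemma sum_block:
  fixes f :: "nat \<Rightarrow> real"
  shows "(\<Sum>r<s * p. f r) = (\<Sum>i<s. \<Sum>k<p. f (i * p + k))"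
proof -
  have "sum f {i * p..<i * p + p} = (\<Sum>k<p. f (i * p + k))" for i
    using sum.shift_bounds_nat_ivl[of f 0 "i * p" p]
    by (simp only: lessThan_atLeast0 add.commute add_0)
  then show ?thesis
    by (simp only: sum.nat_group[symmetric])
qed

lemma transpose_mult_index:
  assumes "A \<in> carrier_mat n u" "B \<in> carrier_mat n v" "i < u" "j < v"
  shows "(A\<^sup>T * B) $$ (i, j) = (\<Sum>r<n. A $$ (r, i) * B $$ (r, j))"
  using assms by (auto simp: scalar_prod_def lessThan_atLeast0)

text \<open>Centring acts on tables, hence this reshaping of the stacked columns of
  \<open>X d a\<close>; subjects and periods start at 0 here.\<close>

definition resp :: "design \<Rightarrow> effect \<Rightarrow> nat \<Rightarrow> nat \<Rightarrow> nat \<Rightarrow> real" where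
  "resp d a h i k = X d a $$ (i * periods d + k, h)"

text \<open>The Gram factor \<open>V\<^sub>a\<close>, stacked again in the row order of
  \<open>X d a\<close>.\<close>

definition centred :: "design \<Rightarrow> effect \<Rightarrow> real mat" where
  "centred d a = mat (subjects d * periods d) (treatments d) (\<lambda>(r, h).
     dbl_center (subjects d) (periods d) (resp d a h) (r div periods d) (r mod periods d))"

lemma X_carrier:
  "X d Subj \<in> carrier_mat (subjects d * periods d) (subjects d)"
  "X d Per \<in> carrier_mat (subjects d * periods d) (periods d)"
  "a \<in> {Dir, Carry} \<Longrightarrow> X d a \<in> carrier_mat (subjects d * periods d) (treatments d)"
  by (auto simp: kronecker_def ones_def)

lemma block_less: "i * p + k < s * p" if "i < s" "k < (p::nat)"
proof -
  have "i * p + k < Suc i * p" using that by simp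
  also have "\<dots> \<le> s * p" using that by (intro mult_le_mono1) simp
  finally show ?thesis .
qed

lemma X_Subj_index:
  assumes "i < subjects d" "k < periods d" "j < subjects d"
  shows "X d Subj $$ (i * periods d + k, j) = of_bool (i = j)"
  using assms block_less[OF assms(1,2)] by (simp add: kronecker_def ones_def)

lemma X_Per_index:
  assumes "i < subjects d" "k < periods d" "j < periods d"
  shows "X d Per $$ (i * periods d + k, j) = of_bool (k = j)"
  using assms block_less[OF assms(1,2)] by (simp add: kronecker_def ones_def)

lemma resp_Dir:
  assumes "i < subjects d" "k < periods d" "h < treatments d"
  shows "resp d Dir h i k = of_bool (assignment d (k + 1) (i + 1) = h)"
  using assms block_less[OF assms(1,2)] by (simp add: resp_def Let_def)

text \<open>Index \<open>k\<close> stands for period \<open>k + 1\<close>, so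
  \<open>assignment d k\<close> is the treatment of the preceding period; the first period,
  \<open>k = 0\<close>, has no carry-over.\<close>

lemma resp_Carry:
  assumes "i < subjects d" "k < periods d" "h < treatments d"
  shows "resp d Carry h i k = of_bool (k \<ge> 1 \<and> assignment d k (i + 1) = h)"
  using assms block_less[OF assms(1,2)] by (auto simp: resp_def Let_def)

context
  fixes d :: design and a :: effect
  assumes a: "a \<in> {Dir, Carry}"
begin

lemma N_index:
  assumes "b \<in> {Dir, Carry}" "h < treatments d" "h' < treatments d"
  shows "N d a b $$ (h, h') =
    (\<Sum>i<subjects d. \<Sum>k<periods d. resp d a h i k * resp d b h' i k)"
  unfolding N_def
  by (subst transpose_mult_index[OF X_carrier(3)[OF a] X_carrier(3)[OF assms(1)] assms(2,3)])
    (simp add: sum_block resp_def)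

lemma N_Subj_index:
  assumes "h < treatments d" "i < subjects d"
  shows "N d a Subj $$ (h, i) = (\<Sum>k<periods d. resp d a h i k)"
proof -
  have "N d a Subj $$ (h, i) =
      (\<Sum>j<subjects d. \<Sum>k<periods d. resp d a h j k * of_bool (j = i))"
    unfolding N_def
    by (subst transpose_mult_index[OF X_carrier(3)[OF a] X_carrier(1) assms])
      (use assms in \<open>simp add: sum_block resp_def X_Subj_index del: X.simps\<close>)
  also have "\<dots> = (\<Sum>k<periods d. resp d a h i k)"
    using assms by (simp flip: sum_distrib_right)
  finally show ?thesis .
qed

lemma N_Per_index:
  assumes "h < treatments d" "k < periods d"
  shows "N d a Per $$ (h, k) = (\<Sum>i<subjects d. resp d a h i k)"
  unfolding N_def
  by (subst transpose_mult_index[OF X_carrier(3)[OF a] X_carrier(2) assms])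
    (use assms in \<open>simp add: sum_block resp_def X_Per_index del: X.simps\<close>)

lemma N_carrier:
  "b \<in> {Dir, Carry} \<Longrightarrow> N d a b \<in> carrier_mat (treatments d) (treatments d)"
  "N d a Subj \<in> carrier_mat (treatments d) (subjects d)"
  "N d a Per \<in> carrier_mat (treatments d) (periods d)"
  using X_carrier(1,2)[of d] X_carrier(3)[OF a, of d] X_carrier(3)[of b d] unfolding N_def by auto

lemma N_commute: "N d b a = (N d a b)\<^sup>T"
proof -
  have "X d b \<in> carrier_mat (subjects d * periods d) (dim_col (X d b))"
    using X_carrier(1,2)[of d] X_carrier(3)[of b d] by (cases b) auto
  then show ?thesis
    using X_carrier(3)[OF a, of d] unfolding N_def
    by (subst transpose_mult[of _ _ "subjects d * periods d"]) auto
qed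

lemma rep_index:
  assumes "h < treatments d"
  shows "rep d a $$ (h, 0) = (\<Sum>i<subjects d. \<Sum>k<periods d. resp d a h i k)"
  using assms N_carrier(2)
  by (simp add: rep_def ones_def scalar_prod_def lessThan_atLeast0[symmetric] N_Subj_index)

lemma rep_carrier: "rep d a \<in> carrier_mat (treatments d) 1"
  using N_carrier(2) by (simp add: rep_def ones_def)

text \<open>A response has at most one treatment of each kind, so the 0/1 columns of
  \<open>X d a\<close> have disjoint supports. This brings \<open>C11\<close> and \<open>C22\<close>
  to the same shape as \<open>C12\<close>, and \<open>info_mat\<close> then covers all
  three.\<close>

lemma rep_diag_eq: "rep_diag d a = N d a a"
proof (rule eq_matI)
  fix h h' assume "h < dim_row (N d a a)" "h' < dim_col (N d a a)"
  then have h: "h < treatments d" "h' < treatments d"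
    using N_carrier(1)[OF a] by auto
  have "resp d a h i k * resp d a h' i k = (if h = h' then resp d a h i k else 0)"
    if "i < subjects d" "k < periods d" for i k
    using a that h by (auto simp: resp_Dir resp_Carry)
  then have "N d a a $$ (h, h') =
      (\<Sum>i<subjects d. \<Sum>k<periods d. if h = h' then resp d a h i k else 0)"
    by (simp add: N_index[OF a h])
  then show "rep_diag d a $$ (h, h') = N d a a $$ (h, h')"
    using h by (simp add: rep_diag_def mat_diag_def rep_index)
qed (use N_carrier(1)[OF a] in \<open>auto simp: rep_diag_def mat_diag_def\<close>)

end

text \<open>The common entry of all blocks, arranged like the right-hand side of
  \<open>sum_dbl_center_mult\<close> so that the Gram form can be read off.\<close>

definition info :: "design \<Rightarrow> effect \<Rightarrow> effect \<Rightarrow> nat \<Rightarrow> nat \<Rightarrow> real" where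
  "info d a b h h' = (\<Sum>i<subjects d. \<Sum>k<periods d. resp d a h i k * resp d b h' i k)
     + (1 / (real (periods d) * real (subjects d))) *
       ((\<Sum>i<subjects d. \<Sum>k<periods d. resp d a h i k) *
        (\<Sum>i<subjects d. \<Sum>k<periods d. resp d b h' i k))
     - (1 / real (periods d)) *
       (\<Sum>i<subjects d. (\<Sum>k<periods d. resp d a h i k) * (\<Sum>k<periods d. resp d b h' i k))
     - (1 / real (subjects d)) *
       (\<Sum>k<periods d. (\<Sum>i<subjects d. resp d a h i k) * (\<Sum>i<subjects d. resp d b h' i k))"

lemma info_mat:
  assumes a: "a \<in> {Dir, Carry}" and b: "b \<in> {Dir, Carry}"
  shows "N d a b
     + (1 / (real (periods d) * real (subjects d))) \<cdot>\<^sub>m (rep d a * (rep d b)\<^sup>T)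
     - (1 / real (periods d)) \<cdot>\<^sub>m (N d a Subj * N d Subj b)
     - (1 / real (subjects d)) \<cdot>\<^sub>m (N d a Per * N d Per b)
     = mat (treatments d) (treatments d) (\<lambda>(h, h'). info d a b h h')" (is "?L = ?R")
proof (rule eq_matI)
  note car = N_carrier(1)[OF a b, of d] N_carrier(2,3)[OF a, of d] N_carrier(2,3)[OF b, of d] rep_carrier[OF a, of d] rep_carrier[OF b, of d]
  note com = N_commute[OF b, of d Subj] N_commute[OF b, of d Per]
  fix h h' assume "h < dim_row ?R" "h' < dim_col ?R"
  then have h: "h < treatments d" "h' < treatments d" by auto
  have 1: "(rep d a * (rep d b)\<^sup>T) $$ (h, h') = rep d a $$ (h, 0) * rep d b $$ (h', 0)"
    using car h by (simp add: scalar_prod_def)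
  have 2: "(N d a Subj * N d Subj b) $$ (h, h') =
      (\<Sum>i<subjects d. N d a Subj $$ (h, i) * N d b Subj $$ (h', i))"
    using car h by (simp add: com scalar_prod_def lessThan_atLeast0)
  have 3: "(N d a Per * N d Per b) $$ (h, h') =
      (\<Sum>k<periods d. N d a Per $$ (h, k) * N d b Per $$ (h', k))"
    using car h by (simp add: com scalar_prod_def lessThan_atLeast0)
  have dims: "dim_row (N d a Subj * N d Subj b) = treatments d" 
    "dim_col (N d a Subj * N d Subj b) = treatments d"
    "dim_row (N d a Per * N d Per b) = treatments d" 
    "dim_col (N d a Per * N d Per b) = treatments d"
    "dim_row (rep d a * (rep d b)\<^sup>T) = treatments d" 
    "dim_col (rep d a * (rep d b)\<^sup>T) = treatments d"
    using car by (auto simp: com)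
  have "?L $$ (h, h') = N d a b $$ (h, h')
     + (1 / (real (periods d) * real (subjects d))) * (rep d a * (rep d b)\<^sup>T) $$ (h, h')
     - (1 / real (periods d)) * (N d a Subj * N d Subj b) $$ (h, h')
     - (1 / real (subjects d)) * (N d a Per * N d Per b) $$ (h, h')"
    using h dims by (simp del: index_mult_mat)
  also have "\<dots> = info d a b h h'"
    unfolding 1 2 3 info_def using h
    by (simp add: N_index[OF a b] N_Subj_index[OF a] N_Subj_index[OF b] N_Per_index[OF a]
        N_Per_index[OF b] rep_index[OF a] rep_index[OF b])
  finally show "?L $$ (h, h') = ?R $$ (h, h')"
    using h by simp
next
  note car = N_carrier(1)[OF a b, of d] N_carrier(2,3)[OF a, of d] N_carrier(2,3)[OF b, of d]
  note com = N_commute[OF b, of d Per]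
  show "dim_row ?L = dim_row ?R" "dim_col ?L = dim_col ?R"
    using car by (auto simp: com)
qed

lemma C_eq_info:
  "C11 d = mat (treatments d) (treatments d) (\<lambda>(h, h'). info d Dir Dir h h')"
  "C22 d = mat (treatments d) (treatments d) (\<lambda>(h, h'). info d Carry Carry h h')"
  "C12 d = mat (treatments d) (treatments d) (\<lambda>(h, h'). info d Dir Carry h h')"
  unfolding C11_def C22_def C12_def Let_def by (simp_all only: rep_diag_eq info_mat insert_iff simp_thms)

lemma centred_carrier: "centred d a \<in> carrier_mat (subjects d * periods d) (treatments d)"
  by (simp add: centred_def)

lemma info_eq_gram:
  assumes "subjects d > 0" "periods d > 0"
  shows "mat (treatments d) (treatments d) (\<lambda>(h, h'). info d a b h h') =
    (centred d a)\<^sup>T * centred d b" (is "?L = ?R")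
proof (rule eq_matI)
  fix h h' assume "h < dim_row ?R" "h' < dim_col ?R"
  then have h: "h < treatments d" "h' < treatments d"
    by (auto simp: centred_def)
  have "centred d c $$ (i * periods d + k, h) =
      dbl_center (subjects d) (periods d) (resp d c h) i k"
    if "i < subjects d" "k < periods d" "h < treatments d" for c i k h
    using that block_less[OF that(1,2)] by (simp add: centred_def)
  then have "?R $$ (h, h') = info d a b h h'"
    unfolding info_def sum_dbl_center_mult[OF assms, symmetric]
    by (subst transpose_mult_index[OF centred_carrier centred_carrier h])
      (simp add: sum_block h)
  then show "?L $$ (h, h') = ?R $$ (h, h')"
    using h by simp
qed (auto simp: centred_def)

section \<open>Generalised inverses of Gram matrices\<close>

text \<open>The diagonal entries of \<open>E\<^sup>T * E\<close> are the squared norms of the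
  columns of \<open>E\<close>.\<close>

lemma gram_zero_imp_zero:
  fixes E :: "real mat"
  assumes E: "E \<in> carrier_mat n u" and "E\<^sup>T * E = 0\<^sub>m u u"
  shows "E = 0\<^sub>m n u"
proof (rule eq_matI)
  fix i j assume "i < dim_row (0\<^sub>m n u :: real mat)" "j < dim_col (0\<^sub>m n u :: real mat)"
  then have ij: "i < n" "j < u" by auto
  have "(\<Sum>r<n. E $$ (r, j) * E $$ (r, j)) = 0"
    using transpose_mult_index[OF E E ij(2) ij(2)] assms(2) ij by simp
  then have "E $$ (i, j) * E $$ (i, j) = 0"
    using ij by (subst (asm) sum_nonneg_eq_0_iff) auto
  then show "E $$ (i, j) = 0\<^sub>m n u $$ (i, j)" using ij by simp
qed (use E in auto)

text \<open>With \<open>K = V\<^sup>T * V\<close>, the error \<open>E = V * (G * K - 1)\<close>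
  satisfies \<open>V\<^sup>T * E = K * G * K - K = 0\<close>. Hence
  \<open>E\<^sup>T * E = 0\<close>, and so \<open>E = 0\<close>.\<close>

lemma gram_g_inverse_absorb:
  fixes V :: "real mat"
  assumes V: "V \<in> carrier_mat n u" and G: "g_inverse (V\<^sup>T * V) G"
  shows "V * G * (V\<^sup>T * V) = V"
proof -
  define K where "K = V\<^sup>T * V"
  define H where "H = G * K - 1\<^sub>m u"
  define E where "E = V * H"
  have K: "K \<in> carrier_mat u u" using V by (simp add: K_def)
  have Gc: "G \<in> carrier_mat u u" and KGK: "K * G * K = K"
    using G V by (auto simp: g_inverse_def K_def)
  have H: "H \<in> carrier_mat u u" using K Gc by (auto simp: H_def)
  have E: "E \<in> carrier_mat n u" using V H by (auto simp: E_def)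
  have "V\<^sup>T * E = K * H"
    using V H by (simp add: E_def K_def)
  also have "\<dots> = K * (G * K) - K"
    using K Gc by (simp add: H_def mult_minus_distrib_mat[of K u u "G * K" u])
  also have "\<dots> = 0\<^sub>m u u"
    using K assoc_mult_mat[OF K Gc K] KGK by simp
  finally have VE: "V\<^sup>T * E = 0\<^sub>m u u" .
  have "E\<^sup>T * E = H\<^sup>T * (V\<^sup>T * E)"
    using V H assoc_mult_mat[of "H\<^sup>T" u u "V\<^sup>T" n "V * H" u]
    by (simp add: E_def transpose_mult[of V n u H u])
  then have "E\<^sup>T * E = 0\<^sub>m u u" using VE H by simp
  then have "V * H = 0\<^sub>m n u"
    using gram_zero_imp_zero[OF E] by (simp add: E_def)
  then have VH: "V * (G * K) - V = 0\<^sub>m n u"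
    using V K Gc by (simp add: H_def mult_minus_distrib_mat[of V n u "G * K" u])
  have "V * (G * K) = V"
  proof (rule eq_matI)
    fix i j assume "i < dim_row V" "j < dim_col V"
    then show "(V * (G * K)) $$ (i, j) = V $$ (i, j)"
      using arg_cong[OF VH, of "\<lambda>M. M $$ (i, j)"] V K Gc by simp
  qed (use V K Gc in auto)
  then show ?thesis
    using assoc_mult_mat[OF V Gc K] by (simp only: K_def)
qed

text \<open>Transposing the absorption law for \<open>G\<close> expresses \<open>V\<^sup>T\<close>
  as \<open>V\<^sup>T * V * (G\<^sup>T * V\<^sup>T)\<close>. Inserted into
  \<open>V * H * V\<^sup>T\<close>, this lets any g-inverse \<open>H\<close> be absorbed, and the
  result no longer contains \<open>H\<close>.\<close>

lemma gram_g_inverse_unique: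
  fixes V :: "real mat"
  assumes V: "V \<in> carrier_mat n u"
    and G: "g_inverse (V\<^sup>T * V) G" and G': "g_inverse (V\<^sup>T * V) G'"
  shows "V * G * V\<^sup>T = V * G' * V\<^sup>T"
proof -
  have Gc: "G \<in> carrier_mat u u" "G' \<in> carrier_mat u u"
    using G G' V by (auto simp: g_inverse_def)
  have sym: "V * H * V\<^sup>T = V * G\<^sup>T * V\<^sup>T" if H: "g_inverse (V\<^sup>T * V) H" for H
  proof -
    have Hc: "H \<in> carrier_mat u u" using H V by (auto simp: g_inverse_def)
    have "(V * G * (V\<^sup>T * V))\<^sup>T = V\<^sup>T * V * (G\<^sup>T * V\<^sup>T)"
      using V Gc by (simp add: transpose_mult[of _ n u _ u] transpose_mult[of _ u n _ u])
    then have "V\<^sup>T = V\<^sup>T * V * (G\<^sup>T * V\<^sup>T)"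
      using gram_g_inverse_absorb[OF V G] by simp
    then have "V * H * V\<^sup>T = V * H * (V\<^sup>T * V * (G\<^sup>T * V\<^sup>T))" by simp
    also have "\<dots> = V * H * (V\<^sup>T * V) * (G\<^sup>T * V\<^sup>T)"
      using V Gc Hc by (simp add: assoc_mult_mat[symmetric, of "V * H" n u "V\<^sup>T * V" u "G\<^sup>T * V\<^sup>T" n])
    also have "\<dots> = V * (G\<^sup>T * V\<^sup>T)"
      using gram_g_inverse_absorb[OF V H] by simp
    finally show ?thesis
      using V Gc by (simp add: assoc_mult_mat[of V n u "G\<^sup>T" u "V\<^sup>T" n])
  qed
  show ?thesis using sym[OF G] sym[OF G'] by simp
qed

text \<open>Regrouping puts the invariant matrix \<open>V * G * V\<^sup>T\<close> in the middle. For
  \<open>C_D\<close> the matrix \<open>V\<close> is the centred carry-over part and \<open>W\<close>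
  the direct part; for \<open>C_R\<close> they change places.\<close>

lemma schur_complement_unique:
  fixes V W :: "real mat"
  assumes V: "V \<in> carrier_mat n u" and W: "W \<in> carrier_mat n v"
    and G: "g_inverse (V\<^sup>T * V) G" and G': "g_inverse (V\<^sup>T * V) G'"
  shows "(W\<^sup>T * V) * G * (V\<^sup>T * W) = (W\<^sup>T * V) * G' * (V\<^sup>T * W)"
proof -
  have "(W\<^sup>T * V) * H * (V\<^sup>T * W) = W\<^sup>T * (V * H * V\<^sup>T) * W" if "g_inverse (V\<^sup>T * V) H" for H
  proof -
    have "H \<in> carrier_mat u u" using that V by (auto simp: g_inverse_def)
    then show ?thesis
      using V W assoc_mult_mat[of "W\<^sup>T" v n V u H u]
        assoc_mult_mat[of "W\<^sup>T * (V * H)" v u "V\<^sup>T" n W v]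
        assoc_mult_mat[of "W\<^sup>T" v n "V * H" u "V\<^sup>T" n]
      by simp
  qed
  then show ?thesis
    using G G' gram_g_inverse_unique[OF V G G'] by simp
qed

section \<open>Independence of \<open>C_D\<close> and \<open>C_R\<close> from the chosen
  g-inverse\<close>

lemma C21_eq_gram:
  assumes "subjects d > 0" "periods d > 0"
  shows "C21 d = (centred d Carry)\<^sup>T * centred d Dir"
  unfolding C21_def C_eq_info info_eq_gram[OF assms]
  using centred_carrier[of d Dir] centred_carrier[of d Carry]
  by (simp add: transpose_mult[of _ _ "subjects d * periods d"])

lemma C_D_eq:
  assumes "subjects d > 0" "periods d > 0" "g_inverse (C22 d) G"
  shows "C_D d = C11 d - C12 d * G * C21 d"
proof -
  \<comment> \<open>The given \<open>G\<close> witnesses existence, so the matrix picked by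
    \<open>SOME\<close> is a g-inverse as well.\<close>
  have "g_inverse (C22 d) (SOME G. g_inverse (C22 d) G)"
    using assms(3) by (rule someI)
  then show ?thesis
    using assms(3) schur_complement_unique[OF centred_carrier[of d Carry] centred_carrier[of d Dir]]
    unfolding C_D_def C21_eq_gram[OF assms(1,2)] C_eq_info info_eq_gram[OF assms(1,2)]
    by metis
qed

lemma C_R_eq:
  assumes "subjects d > 0" "periods d > 0" "g_inverse (C11 d) G"
  shows "C_R d = C22 d - C21 d * G * C12 d"
proof -
  have "g_inverse (C11 d) (SOME G. g_inverse (C11 d) G)"
    using assms(3) by (rule someI)
  then show ?thesis
    using assms(3) schur_complement_unique[OF centred_carrier[of d Dir] centred_carrier[of d Carry]]
    unfolding C_R_def C21_eq_gram[OF assms(1,2)] C_eq_info info_eq_gram[OF assms(1,2)]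
    by metis
qed

section \<open>Counting in a uniform balanced design\<close>

lemma sum_of_bool_eq_shift:
  fixes n :: nat
  shows "(\<Sum>i<n. of_bool (Q (i + 1))) = (of_nat (card {i \<in> {1..n}. Q i}) :: real)"
proof -
  have "(\<Sum>i<n. of_bool (Q (i + 1)) :: real) = (\<Sum>i\<in>{1..n}. of_bool (Q i))"
    by (rule sum.reindex_bij_witness[of _ "\<lambda>i. i - 1" "\<lambda>i. i + 1"]) auto
  then show ?thesis
    by (simp add: sum.If_cases of_bool_def Int_def)
qed

locale UBRMD_design =
  fixes t g :: nat and d :: design
  assumes ubrmd: "UBRMD t g d" and t: "t > 1" and g: "g > 0"
begin

text \<open>Periods and subjects are numbered from 0 here, but from 1 in \<open>assignment\<close>.\<close>

definition y :: "nat \<Rightarrow> nat \<Rightarrow> nat \<Rightarrow> real" where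
  "y k i h = of_bool (assignment d (k + 1) (i + 1) = h)"

lemma params: "treatments d = t" "periods d = t" "subjects d = g * t"
  using ubrmd by (auto simp: UBRMD_def)

lemma y_nonneg: "0 \<le> y k i h"
  by (simp add: y_def)

lemma y_mult: "y k i a * y k i b = (if a = b then y k i a else 0)"
  by (simp add: y_def)

lemma sum_treatment:
  assumes "k < t" "i < g * t"
  shows "(\<Sum>h<t. y k i h) = 1"
proof -
  have "assignment d (k + 1) (i + 1) < t"
    using ubrmd assms by (auto simp: UBRMD_def crossover_design_def)
  then show ?thesis by (simp add: y_def of_bool_def)
qed

text \<open>Uniformity provides only some constant \<open>n\<close>; counting the \<open>t\<close>
  periods of one subject by treatment gives \<open>t * n = t\<close>. The proof of
  \<open>sum_subject\<close> counts the subjects of one period in the same way.\<close>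

lemma sum_period:
  assumes "i < g * t" "h < t"
  shows "(\<Sum>k<t. y k i h) = 1"
proof -
  obtain n where "\<forall>i\<in>{1..g * t}. \<forall>a<t. card {k\<in>{1..t}. assignment d k i = a} = n"
    using ubrmd unfolding UBRMD_def uniform_design_def by metis
  then have n: "(\<Sum>k<t. y k i h) = real n" if "h < t" for h
    using assms(1) that sum_of_bool_eq_shift[of "\<lambda>k. assignment d k (i + 1) = h" t]
    by (simp add: y_def)
  have "real t * real n = (\<Sum>h<t. \<Sum>k<t. y k i h)"
    by (simp add: n)
  also have "\<dots> = (\<Sum>k<t. \<Sum>h<t. y k i h)"
    by (rule sum.swap)
  also have "\<dots> = real t"
    using assms by (simp add: sum_treatment)
  finally show ?thesis using t n[OF assms(2)] by simp
qed

lemma sum_subject: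
  assumes "k < t" "h < t"
  shows "(\<Sum>i<g * t. y k i h) = real g"
proof -
  obtain n where "\<forall>k\<in>{1..t}. \<forall>a<t. card {i\<in>{1..g * t}. assignment d k i = a} = n"
    using ubrmd unfolding UBRMD_def uniform_design_def by metis
  then have n: "(\<Sum>i<g * t. y k i h) = real n" if "h < t" for h
    using assms(1) that sum_of_bool_eq_shift[of "\<lambda>i. assignment d (k + 1) i = h" "g * t"]
    by (simp add: y_def)
  have "real t * real n = (\<Sum>h<t. \<Sum>i<g * t. y k i h)"
    by (simp add: n)
  also have "\<dots> = (\<Sum>i<g * t. \<Sum>h<t. y k i h)"
    by (rule sum.swap)
  also have "\<dots> = real g * real t"
    using assms by (simp add: sum_treatment)
  finally show ?thesis using t n[OF assms(2)] by simp
qed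

lemma times_preceded_eq:
  "real (times_preceded d a b) = (\<Sum>k<t - 1. \<Sum>i<g * t. y (k + 1) i a * y k i b)"
proof -
  let ?Q = "\<lambda>k i. assignment d k i = a \<and> assignment d (k - 1) i = b"
  have "{(k, i). k \<in> {2..t} \<and> i \<in> {1..g * t} \<and> ?Q k i} =
      Sigma {2..t} (\<lambda>k. {i \<in> {1..g * t}. ?Q k i})"
    by auto
  then have "real (times_preceded d a b) = (\<Sum>k\<in>{2..t}. real (card {i \<in> {1..g * t}. ?Q k i}))"
    by (simp add: times_preceded_def params)
  also have "\<dots> = (\<Sum>k\<in>{2..t}. \<Sum>i<g * t. of_bool (?Q k (i + 1)))"
    by (intro sum.cong refl sum_of_bool_eq_shift[symmetric])
  \<comment> \<open>Period \<open>k + 2\<close> counted from 1 is period \<open>k + 1\<close> for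
    \<open>y\<close>, and its predecessor is period \<open>k\<close>.\<close>
  also have "\<dots> = (\<Sum>k<t - 1. \<Sum>i<g * t. of_bool (?Q (k + 2) (i + 1)))"
    by (rule sum.reindex_bij_witness[of _ "\<lambda>k. k + 2" "\<lambda>k. k - 2"])
      (auto simp: numeral_2_eq_2 Suc_diff_Suc)
  also have "\<dots> = (\<Sum>k<t - 1. \<Sum>i<g * t. y (k + 1) i a * y k i b)"
    by (simp add: y_def flip: of_bool_conj)
  finally show ?thesis .
qed

text \<open>Double counting fixes the constant of balance: the \<open>g * t\<close> subjects have
  \<open>t - 1\<close> consecutive pairs each, shared equally by the \<open>t * (t - 1)\<close>
  ordered pairs of distinct treatments.\<close>

lemma sum_preceded:
  assumes "a < t" "b < t"
  shows "(\<Sum>k<t - 1. \<Sum>i<g * t. y (k + 1) i a * y k i b) = (if a = b then 0 else real g)"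
proof -
  obtain n where n: "\<And>a b. a < t \<Longrightarrow> b < t \<Longrightarrow> a \<noteq> b \<Longrightarrow> times_preceded d a b = n"
    and z: "\<And>a. a < t \<Longrightarrow> times_preceded d a a = 0"
    using ubrmd unfolding UBRMD_def balanced_design_def by metis
  have row: "(\<Sum>b<t. real (times_preceded d a b)) = real (t - 1) * real n" if "a < t" for a
  proof -
    have "(\<Sum>b<t. real (times_preceded d a b)) = (\<Sum>b\<in>{..<t} - {a}. real n)"
      using that n z by (subst sum.remove[of _ a]) auto
    then show ?thesis using that by simp
  qed
  have "(\<Sum>a<t. \<Sum>b<t. real (times_preceded d a b)) = real t * real (t - 1) * real n"
    using t by (simp add: row)
  moreover have "(\<Sum>a<t. \<Sum>b<t. real (times_preceded d a b)) =
      (\<Sum>k<t - 1. \<Sum>i<g * t. (\<Sum>a<t. y (k + 1) i a) * (\<Sum>b<t. y k i b))"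
  proof -
    let ?f = "\<lambda>a b k i. y (k + 1) i a * y k i b"
    have "(\<Sum>a<t. \<Sum>b<t. \<Sum>k<t - 1. \<Sum>i<g * t. ?f a b k i) =
        (\<Sum>a<t. \<Sum>k<t - 1. \<Sum>b<t. \<Sum>i<g * t. ?f a b k i)"
      by (intro sum.cong refl sum.swap)
    also have "\<dots> = (\<Sum>k<t - 1. \<Sum>a<t. \<Sum>b<t. \<Sum>i<g * t. ?f a b k i)"
      by (rule sum.swap)
    also have "\<dots> = (\<Sum>k<t - 1. \<Sum>a<t. \<Sum>i<g * t. \<Sum>b<t. ?f a b k i)"
      by (intro sum.cong refl sum.swap)
    also have "\<dots> = (\<Sum>k<t - 1. \<Sum>i<g * t. \<Sum>a<t. \<Sum>b<t. ?f a b k i)"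
      by (intro sum.cong refl sum.swap)
    finally show ?thesis
      by (simp only: times_preceded_eq sum_product)
  qed
  moreover have "\<dots> = real (t - 1) * (real g * real t)"
    using t by (simp add: sum_treatment)
  ultimately have "real n = real g"
    using t by simp
  then have "real (times_preceded d a b) = (if a = b then 0 else real g)"
    using n z assms by auto
  then show ?thesis
    by (simp only: times_preceded_eq)
qed

lemma total_first_periods:
  assumes "n \<le> t" "h < t"
  shows "(\<Sum>i<g * t. \<Sum>k<t - n. y k i h) = real g * real (t - n)"
  by (subst sum.swap) (use assms in \<open>simp add: sum_subject\<close>)

text \<open>The entries of \<open>U\<^sub>j\<^sub>k\<close>: period \<open>t - j\<close> counted
  from 1 is \<open>t - Suc j\<close> for \<open>y\<close>.\<close>

definition u :: "nat \<Rightarrow> nat \<Rightarrow> nat \<Rightarrow> nat \<Rightarrow> real" where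
  "u j k a b = (\<Sum>i<g * t. y (t - Suc j) i a * y (t - Suc k) i b)"

lemma U_index:
  assumes "j < t" "k < t" "a < t" "b < t"
  shows "U d j k $$ (a, b) = u j k a b"
proof -
  have *: "t - j = Suc (t - Suc j)" "t - k = Suc (t - Suc k)"
    using assms by auto
  show ?thesis
    unfolding U_def P_def params u_def y_def *
    using assms by (simp add: scalar_prod_def lessThan_atLeast0 of_bool_def)
qed

lemma u_nonneg: "0 \<le> u j k a b"
  by (simp add: u_def y_nonneg sum_nonneg)

lemma u_diag: "j < t \<Longrightarrow> a < t \<Longrightarrow> u j j a b = (if a = b then real g else 0)"
  by (simp add: u_def y_mult sum_subject)

lemma u_row_sum:
  assumes "j < t" "k < t" "a < t"
  shows "(\<Sum>b<t. u j k a b) = real g"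
proof -
  have "(\<Sum>b<t. u j k a b) = (\<Sum>i<g * t. y (t - Suc j) i a * (\<Sum>b<t. y (t - Suc k) i b))"
    unfolding u_def sum_distrib_left by (rule sum.swap)
  then show ?thesis
    using assms by (simp add: sum_treatment sum_subject)
qed

text \<open>The periods cut off are listed backwards from the last one, to match the indices of
  \<open>U\<^sub>j\<^sub>k\<close>.\<close>

definition tail :: "nat \<Rightarrow> nat \<Rightarrow> nat \<Rightarrow> real" where
  "tail n i h = (\<Sum>j<n. y (t - Suc j) i h)"

lemma sum_first_periods:
  assumes "n \<le> t" "i < g * t" "h < t"
  shows "(\<Sum>k<t - n. y k i h) = 1 - tail n i h"
proof -
  have "(\<Sum>j<n. y (t - Suc j) i h) = (\<Sum>k\<in>{t - n..<t}. y k i h)"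
    using assms(1)
    by (intro sum.reindex_bij_witness[of _ "\<lambda>k. t - Suc k" "\<lambda>j. t - Suc j"]) auto
  moreover have "(\<Sum>k<t. y k i h) = (\<Sum>k<t - n. y k i h) + (\<Sum>k\<in>{t - n..<t}. y k i h)"
    using assms(1) by (simp add: lessThan_atLeast0 sum.atLeastLessThan_concat)
  ultimately show ?thesis
    using assms sum_period by (simp add: tail_def)
qed

lemma sum_tail:
  assumes "n \<le> t" "h < t"
  shows "(\<Sum>i<g * t. tail n i h) = real n * real g"
proof -
  have "(\<Sum>i<g * t. tail n i h) = (\<Sum>j<n. \<Sum>i<g * t. y (t - Suc j) i h)"
    unfolding tail_def by (rule sum.swap)
  then show ?thesis
    using assms t by (simp add: sum_subject)
qed

lemma sum_tail_mult:
  "(\<Sum>i<g * t. tail n i a * tail n' i b) = (\<Sum>j<n. \<Sum>k<n'. u j k a b)"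
proof -
  let ?f = "\<lambda>i j k. y (t - Suc j) i a * y (t - Suc k) i b"
  have "(\<Sum>i<g * t. \<Sum>j<n. \<Sum>k<n'. ?f i j k) = (\<Sum>j<n. \<Sum>i<g * t. \<Sum>k<n'. ?f i j k)"
    by (rule sum.swap)
  also have "\<dots> = (\<Sum>j<n. \<Sum>k<n'. \<Sum>i<g * t. ?f i j k)"
    by (intro sum.cong refl sum.swap)
  finally show ?thesis
    by (simp add: tail_def u_def sum_product)
qed

text \<open>These are the entries of the subject terms such as
  \<open>N d Dir Subj * N d Subj Carry\<close>. Each factor is 1 minus a tail count; the linear
  terms give multiples of \<open>g\<close> and the product of the tails gives the
  \<open>u j k\<close>.\<close>

lemma sum_replication:
  assumes "n \<le> n'" "n' \<le> t" "a < t" "b < t"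
  shows "(\<Sum>i<g * t. (\<Sum>k<t - n. y k i a) * (\<Sum>k<t - n'. y k i b)) =
    real g * (real t - real n - real n') + (if a = b then real n * real g else 0)
    + (\<Sum>j<n. \<Sum>k\<in>{..<n'} - {j}. u j k a b)"
proof -
  have "(\<Sum>i<g * t. (\<Sum>k<t - n. y k i a) * (\<Sum>k<t - n'. y k i b)) =
      (\<Sum>i<g * t. 1 - tail n i a - tail n' i b + tail n i a * tail n' i b)"
    using assms by (simp add: sum_first_periods algebra_simps)
  also have "\<dots> = real g * real t - real n * real g - real n' * real g
      + (\<Sum>j<n. \<Sum>k<n'. u j k a b)"
    using assms by (simp add: sum.distrib sum_subtractf sum_tail sum_tail_mult)
  \<comment> \<open>As \<open>n \<le> n'\<close>, each \<open>j\<close> also occurs as a value of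
    \<open>k\<close>; these diagonal terms are entries of \<open>g\<close> times the
    identity.\<close>
  also have "(\<Sum>j<n. \<Sum>k<n'. u j k a b) =
      (\<Sum>j<n. u j j a b + (\<Sum>k\<in>{..<n'} - {j}. u j k a b))"
    using assms by (intro sum.cong refl sum.remove) auto
  also have "\<dots> = (if a = b then real n * real g else 0)
      + (\<Sum>j<n. \<Sum>k\<in>{..<n'} - {j}. u j k a b)"
    using assms by (simp add: sum.distrib u_diag)
  finally show ?thesis by (simp add: algebra_simps)
qed

end

lemma J_mat_index: "a < n \<Longrightarrow> b < n \<Longrightarrow> J_mat n $$ (a, b) = 1"
  by (simp add: J_mat_def ones_def scalar_prod_def)

lemma J_mat_dim [simp]: "dim_row (J_mat n) = n" "dim_col (J_mat n) = n"
  by (simp_all add: J_mat_def ones_def)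

section \<open>The truncated design\<close>

context UBRMD_design
begin

text \<open>The two bounds are \<open>m, m\<close> for \<open>C11\<close>,
  \<open>m + 1, m + 1\<close> for \<open>C22\<close> and \<open>m, m + 1\<close> for
  \<open>C12\<close>.\<close>

definition u_offdiag :: "nat \<Rightarrow> nat \<Rightarrow> nat \<Rightarrow> nat \<Rightarrow> real" where
  "u_offdiag n n' a b = (\<Sum>j<n. \<Sum>k\<in>{..<n'} - {j}. u j k a b)"

lemma u_offdiag_nonneg: "0 \<le> u_offdiag n n' a b"
  by (simp add: u_offdiag_def u_nonneg sum_nonneg)

text \<open>There are \<open>n * (n + 1)\<close> ordered pairs of distinct indices, and each
  \<open>U\<^sub>j\<^sub>k\<close> has row sums \<open>g\<close>. This yields the row sums of
  \<open>A\<close>.\<close>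

lemma u_offdiag_row_sum:
  assumes "n < t" "a < t"
  shows "(\<Sum>b<t. u_offdiag (Suc n) (Suc n) a b) = real g * (real n * (real n + 1))"
proof -
  have "(\<Sum>b<t. u_offdiag (Suc n) (Suc n) a b) =
      (\<Sum>j<Suc n. \<Sum>b<t. \<Sum>k\<in>{..<Suc n} - {j}. u j k a b)"
    unfolding u_offdiag_def by (rule sum.swap)
  also have "\<dots> = (\<Sum>j<Suc n. \<Sum>k\<in>{..<Suc n} - {j}. \<Sum>b<t. u j k a b)"
    by (intro sum.cong refl sum.swap)
  also have "\<dots> = (\<Sum>j<Suc n. \<Sum>k\<in>{..<Suc n} - {j}. real g)"
    using assms by (intro sum.cong refl) (auto simp: u_row_sum)
  finally show ?thesis by (simp add: algebra_simps)
qed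

lemma sum_U_offdiag:
  assumes "n < t" "a < t" "b < t"
  shows "(\<Sum>x\<in>{(j, k). j \<le> n \<and> k \<le> n \<and> j \<noteq> k}. (case x of (j, k) \<Rightarrow> U d j k) $$ (a, b)) =
    u_offdiag (Suc n) (Suc n) a b"
proof -
  have "{(j, k). j \<le> n \<and> k \<le> n \<and> j \<noteq> k} = Sigma {..<Suc n} (\<lambda>j. {..<Suc n} - {j})"
    by auto
  then have "(\<Sum>x\<in>{(j, k). j \<le> n \<and> k \<le> n \<and> j \<noteq> k}. (case x of (j, k) \<Rightarrow> U d j k) $$ (a, b)) =
      (\<Sum>j<Suc n. \<Sum>k\<in>{..<Suc n} - {j}. U d j k $$ (a, b))"
    by (simp add: sum.Sigma split_beta del: sum.lessThan_Suc)
  also have "\<dots> = u_offdiag (Suc n) (Suc n) a b"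
    unfolding u_offdiag_def using assms by (intro sum.cong refl) (auto simp: U_index)
  finally show ?thesis .
qed

context
  fixes m :: nat
  assumes m: "m < t - 1"
begin

abbreviation "d_min \<equiv> first_periods (t - m) d"

lemma params_min: "periods d_min = t - m" "subjects d_min = g * t" "treatments d_min = t"
  "assignment d_min = assignment d"
  by (simp_all add: first_periods_def params)

text \<open>Serves to split off the first period, where the carry-over columns vanish.\<close>

lemma periods_Suc: "t - m = Suc (t - Suc m)"
  using m by simp

section \<open>Subject, period and total counts in the truncated design\<close>

context
  fixes h assumes h: "h < t"
begin

lemma resp_Dir_min: "i < g * t \<Longrightarrow> k < t - m \<Longrightarrow> resp d_min Dir h i k = y k i h"
  using h by (subst resp_Dir) (auto simp: params_min y_def)

lemma resp_Carry_min:
  "i < g * t \<Longrightarrow> k < t - m \<Longrightarrow> resp d_min Carry h i k = (if k = 0 then 0 else y (k - 1) i h)"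
  using h by (subst resp_Carry) (auto simp: params_min y_def)

lemma sum_resp_Dir_min: "i < g * t \<Longrightarrow> (\<Sum>k<t - m. resp d_min Dir h i k) = (\<Sum>k<t - m. y k i h)"
  by (simp add: resp_Dir_min)

text \<open>The treatment of the last retained period has no carry-over within the design, so one
  period fewer is counted.\<close>

lemma sum_resp_Carry_min:
  assumes "i < g * t"
  shows "(\<Sum>k<t - m. resp d_min Carry h i k) = (\<Sum>k<t - Suc m. y k i h)"
proof -
  have "(\<Sum>k<t - m. resp d_min Carry h i k) = (\<Sum>k<t - m. if k = 0 then 0 else y (k - 1) i h)"
    using assms by (simp add: resp_Carry_min)
  then show ?thesis
    by (simp only: periods_Suc sum.lessThan_Suc_shift) simp
qed

lemma sum_subj_Dir_min: "k < t - m \<Longrightarrow> (\<Sum>i<g * t. resp d_min Dir h i k) = real g"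
  using h by (simp add: resp_Dir_min sum_subject)

lemma sum_subj_Carry_min:
  "k < t - m \<Longrightarrow> (\<Sum>i<g * t. resp d_min Carry h i k) = (if k = 0 then 0 else real g)"
  using h by (simp add: resp_Carry_min sum_subject)

lemma total_Dir: "(\<Sum>i<g * t. \<Sum>k<t - m. resp d_min Dir h i k) = real g * real (t - m)"
  by (subst sum.swap) (simp add: sum_subj_Dir_min)

lemma total_Carry: "(\<Sum>i<g * t. \<Sum>k<t - m. resp d_min Carry h i k) = real g * real (t - Suc m)"
proof -
  have "(\<Sum>i<g * t. \<Sum>k<t - m. resp d_min Carry h i k) = (\<Sum>k<t - m. if k = 0 then 0 else real g)"
    by (subst sum.swap) (simp add: sum_subj_Carry_min)
  then show ?thesis
    by (simp only: periods_Suc sum.lessThan_Suc_shift) simp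
qed

end

section \<open>Entries of the information matrix of the truncated design\<close>

context
  fixes a b assumes a: "a < t" and b: "b < t"
begin

lemma sum_Dir_Dir:
  "(\<Sum>i<g * t. \<Sum>k<t - m. resp d_min Dir a i k * resp d_min Dir b i k) =
    (if a = b then real g * real (t - m) else 0)"
proof -
  have "(\<Sum>i<g * t. \<Sum>k<t - m. resp d_min Dir a i k * resp d_min Dir b i k) =
    (\<Sum>i<g * t. \<Sum>k<t - m. if a = b then resp d_min Dir a i k else 0)"
    using a b by (intro sum.cong refl) (simp add: resp_Dir_min y_mult)
  then show ?thesis using total_Dir[OF a] total_Dir[OF b] by simp
qed

lemma sum_Carry_Carry:
  "(\<Sum>i<g * t. \<Sum>k<t - m. resp d_min Carry a i k * resp d_min Carry b i k) =
    (if a = b then real g * real (t - Suc m) else 0)"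
proof -
  have "(\<Sum>i<g * t. \<Sum>k<t - m. resp d_min Carry a i k * resp d_min Carry b i k) =
    (\<Sum>i<g * t. \<Sum>k<t - m. if a = b then resp d_min Carry a i k else 0)"
    using a b by (intro sum.cong refl) (auto simp: resp_Carry_min y_def)
  then show ?thesis using total_Carry[OF a] total_Carry[OF b] by simp
qed

text \<open>Balance settles the count over all consecutive periods of the full design; truncation
  loses the last \<open>m\<close> transitions, from period \<open>t - j - 1\<close> to
  \<open>t - j\<close> for \<open>j < m\<close>.\<close>

lemma sum_Dir_Carry:
  "(\<Sum>i<g * t. \<Sum>k<t - m. resp d_min Dir a i k * resp d_min Carry b i k) =
    (if a = b then 0 else real g) - (\<Sum>j<m. u j (j + 1) a b)"
proof -
  let ?f = "\<lambda>k. \<Sum>i<g * t. y (k + 1) i a * y k i b"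
  have "(\<Sum>i<g * t. \<Sum>k<t - m. resp d_min Dir a i k * resp d_min Carry b i k) =
    (\<Sum>k<t - m. \<Sum>i<g * t. if k = 0 then 0 else y k i a * y (k - 1) i b)"
    by (subst sum.swap) (use a b in \<open>intro sum.cong refl; simp add: resp_Dir_min resp_Carry_min\<close>)
  also have "\<dots> = (\<Sum>k<t - Suc m. ?f k)"
    by (simp only: periods_Suc sum.lessThan_Suc_shift) simp
  also have "\<dots> = (\<Sum>k<t - 1. ?f k) - (\<Sum>k\<in>{t - Suc m..<t - 1}. ?f k)"
    using sum.atLeastLessThan_concat[of 0 "t - Suc m" "t - 1" ?f] diff_le_mono2[of 1 "Suc m" t]
    by (simp add: lessThan_atLeast0)
  also have "(\<Sum>k\<in>{t - Suc m..<t - 1}. ?f k) = (\<Sum>j<m. u j (j + 1) a b)"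
    unfolding u_def
    by (rule sum.reindex_bij_witness[of _ "\<lambda>j. t - Suc (Suc j)" "\<lambda>k. t - Suc (Suc k)"])
      (use m in \<open>auto simp: Suc_diff_Suc\<close>)
  finally show ?thesis using sum_preceded[OF a b] by simp
qed

lemma info_Dir_Dir:
  "info d_min Dir Dir a b = (if a = b then real g * ((real t - real m)\<^sup>2 - real m) / (real t - real m) else 0)
     - real g * (real t - 2 * real m) / (real t - real m)
     - (1 / (real t - real m)) * u_offdiag m m a b"
proof -
  \<comment> \<open>Eliminating \<open>m\<close> in favour of \<open>q\<close> leaves only the
    nonzero denominators \<open>q\<close>, \<open>g\<close> and \<open>t\<close>, which
    \<open>field_simps\<close> can clear.\<close>
  define q where "q = real t - real m"
  have mq: "real m = real t - q" and p: "real (t - m) = q" and nz: "q \<noteq> 0" "g \<noteq> 0" "t \<noteq> 0"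
    using m g by (auto simp: q_def)
  have "info d_min Dir Dir a b = (if a = b then real g * real (t - m) else 0)
     + (1 / (real (t - m) * real (g * t))) * ((real g * real (t - m)) * (real g * real (t - m)))
     - (1 / real (t - m)) * (real g * (real t - real m - real m) + (if a = b then real m * real g else 0)
         + u_offdiag m m a b)
     - (1 / real (g * t)) * (real (t - m) * (real g * real g))"
    unfolding info_def params_min u_offdiag_def
    using a b m
    by (simp add: sum_Dir_Dir total_first_periods sum_resp_Dir_min sum_replication sum_subj_Dir_min)
  note eq = this[unfolded p of_nat_mult of_nat_Suc mq]
  show ?thesis
    unfolding eq q_def[symmetric] unfolding mq
    using nz by (cases "a = b") (simp_all add: field_simps power2_eq_square)
qed

text \<open>With \<open>q = t - m\<close>, the extra diagonal term is
  \<open>g * (q - 1) - g * (m + 1) / q\<close>, which is \<open>g / q\<close> times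
  \<open>q^2 - (t + 1)\<close> because \<open>q + m = t\<close>.\<close>

lemma info_Carry_Carry:
  "info d_min Carry Carry a b = real g / (real t - real m) *
      ((if a = b then (real t - real m)\<^sup>2 - (real t + 1) else 0)
       - 1 / real t * ((real t - real m)\<^sup>2 - (real t + 1) - real m * (real m + 1)))
     - (1 / (real t - real m)) * u_offdiag (Suc m) (Suc m) a b"
proof -
  define q where "q = real t - real m"
  have mq: "real m = real t - q" and p: "real (t - m) = q" "real (t - Suc m) = q - 1"
    and nz: "q \<noteq> 0" "g \<noteq> 0" "t \<noteq> 0"
    using m g by (auto simp: q_def)
  have "(\<Sum>k<t - m. (\<Sum>i<g * t. resp d_min Carry a i k) * (\<Sum>i<g * t. resp d_min Carry b i k)) =
      (\<Sum>k<t - m. if k = 0 then 0 else real g * real g)"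
    using a b by (intro sum.cong refl) (simp add: sum_subj_Carry_min)
  also have "\<dots> = real (t - Suc m) * (real g * real g)"
    by (simp only: periods_Suc sum.lessThan_Suc_shift) simp
  finally have "info d_min Carry Carry a b = (if a = b then real g * real (t - Suc m) else 0)
     + (1 / (real (t - m) * real (g * t))) * ((real g * real (t - Suc m)) * (real g * real (t - Suc m)))
     - (1 / real (t - m)) * (real g * (real t - real (Suc m) - real (Suc m))
         + (if a = b then real (Suc m) * real g else 0)
         + u_offdiag (Suc m) (Suc m) a b)
     - (1 / real (g * t)) * (real (t - Suc m) * (real g * real g))"
    unfolding info_def params_min u_offdiag_def
    using a b m
    by (simp add: sum_Carry_Carry total_first_periods sum_resp_Carry_min sum_replication del: of_nat_Suc)
  note eq = this[unfolded p of_nat_mult of_nat_Suc mq]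
  show ?thesis
    unfolding eq q_def[symmetric] unfolding mq
    using nz by (cases "a = b") (simp_all add: field_simps power2_eq_square)
qed

text \<open>On the diagonal, balance takes away \<open>g\<close> and the subject term a further
  \<open>g * m / (t - m)\<close>; together they form the coefficient \<open>g * t / (t - m)\<close>
  of the identity.\<close>

lemma info_Dir_Carry:
  "info d_min Dir Carry a b = real g / (real t - real m) * ((real m + 1) - (if a = b then real t else 0))
     - (\<Sum>j<m. u j (j + 1) a b)
     - (1 / (real t - real m)) * u_offdiag m (Suc m) a b"
proof -
  define q where "q = real t - real m"
  have mq: "real m = real t - q" and p: "real (t - m) = q" "real (t - Suc m) = q - 1"
    and nz: "q \<noteq> 0" "g \<noteq> 0" "t \<noteq> 0"
    using m g by (auto simp: q_def)
  have "(\<Sum>k<t - m. (\<Sum>i<g * t. resp d_min Dir a i k) * (\<Sum>i<g * t. resp d_min Carry b i k)) =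
      (\<Sum>k<t - m. if k = 0 then 0 else real g * real g)"
    using a b by (intro sum.cong refl) (simp add: sum_subj_Carry_min sum_subj_Dir_min)
  also have "\<dots> = real (t - Suc m) * (real g * real g)"
    by (simp only: periods_Suc sum.lessThan_Suc_shift) simp
  finally have "info d_min Dir Carry a b = (if a = b then 0 else real g) - (\<Sum>j<m. u j (j + 1) a b)
     + (1 / (real (t - m) * real (g * t))) * ((real g * real (t - m)) * (real g * real (t - Suc m)))
     - (1 / real (t - m)) * (real g * (real t - real m - real (Suc m))
         + (if a = b then real m * real g else 0)
         + u_offdiag m (Suc m) a b)
     - (1 / real (g * t)) * (real (t - Suc m) * (real g * real g))"
    unfolding info_def params_min u_offdiag_def
    using a b m
    by (simp add: sum_Dir_Carry total_first_periods sum_resp_Carry_min sum_resp_Dir_min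
        sum_replication del: of_nat_Suc)
  note eq = this[unfolded p of_nat_mult of_nat_Suc mq]
  show ?thesis
    unfolding eq q_def[symmetric] unfolding mq
    using nz by (cases "a = b") (simp_all add: field_simps power2_eq_square)
qed

end

section \<open>Closed forms of the three blocks\<close>

lemma C11_formula:
  assumes "1 \<le> m"
  shows "C11 d_min =
    (real g * ((real t - real m)^2 - real m) / (real t - real m)) \<cdot>\<^sub>m 1\<^sub>m t
    - (real g * (real t - 2 * real m) / (real t - real m)) \<cdot>\<^sub>m J_mat t
    - (1 / (real t - real m)) \<cdot>\<^sub>m
        mat_sum t t (\<lambda>(j, k). U d j k) {(j, k). j \<le> m - 1 \<and> k \<le> m - 1 \<and> j \<noteq> k}"
  unfolding C_eq_info params_min mat_sum_def
  by (rule eq_matI) (use assms m sum_U_offdiag[of "m - 1"] in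
      \<open>simp_all add: info_Dir_Dir J_mat_index\<close>)

lemma C22_formula:
  "C22 d_min =
    (real g / (real t - real m)) \<cdot>\<^sub>m
      (((real t - real m)^2 - (real t + 1)) \<cdot>\<^sub>m 1\<^sub>m t
       - ((1 / real t) *
           ((real t - real m)^2 - (real t + 1) - real m * (real m + 1))) \<cdot>\<^sub>m J_mat t)
    - (1 / (real t - real m)) \<cdot>\<^sub>m
        mat_sum t t (\<lambda>(j, k). U d j k) {(j, k). j \<le> m \<and> k \<le> m \<and> j \<noteq> k}"
  unfolding C_eq_info params_min mat_sum_def
  by (rule eq_matI) (use m sum_U_offdiag[of m] in
      \<open>simp_all add: info_Carry_Carry J_mat_index\<close>)

lemma C12_formula:
  assumes "1 \<le> m"
  shows "C12 d_min =
    (real g / (real t - real m)) \<cdot>\<^sub>m ((real m + 1) \<cdot>\<^sub>m J_mat t - real t \<cdot>\<^sub>m 1\<^sub>m t)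
    - mat_sum t t (\<lambda>j. U d j (j + 1)) {0..m - 1}
    - (1 / (real t - real m)) \<cdot>\<^sub>m
        mat_sum t t (\<lambda>j. mat_sum t t (\<lambda>k. U d j k) {k. k \<le> m \<and> k \<noteq> j}) {0..m - 1}"
proof -
  \<comment> \<open>The subtraction is on naturals: \<open>1 \<le> m\<close> keeps
    \<open>{0..m - 1}\<close> from being \<open>{0}\<close> at \<open>m = 0\<close>.\<close>
  have sets: "{0..m - 1} = {..<m}" "{k. k \<le> m \<and> k \<noteq> j} = {..<Suc m} - {j}" for j
    using assms by auto
  have "(\<Sum>j<m. U d j (j + 1) $$ (a, b)) = (\<Sum>j<m. u j (j + 1) a b)"
    "(\<Sum>j<m. \<Sum>k\<in>{..<Suc m} - {j}. U d j k $$ (a, b)) = u_offdiag m (Suc m) a b"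
    if "a < t" "b < t" for a b
    unfolding u_offdiag_def using that m by (auto intro!: sum.cong simp: U_index)
  then show ?thesis
    unfolding C_eq_info params_min mat_sum_def sets
    by (intro eq_matI) (simp_all add: info_Dir_Carry J_mat_index)
qed

end

end

section \<open>The generalised inverse of \<open>C22\<close>\<close>

text \<open>An entry of a kernel vector of maximal modulus is dominated by itself, hence zero.\<close>

lemma det_diagonally_dominant:
  fixes E :: "nat \<Rightarrow> nat \<Rightarrow> real"
  assumes E: "\<And>a b. 0 \<le> E a b" and row: "\<And>a. a < n \<Longrightarrow> (\<Sum>b<n. E a b) < \<alpha>"
  shows "det (mat n n (\<lambda>(a, b). (if a = b then \<alpha> else 0) - E a b)) \<noteq> 0" (is "det ?A \<noteq> 0")
proof
  assume "det ?A = 0"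
  then obtain v where v: "v \<in> carrier_vec n" "v \<noteq> 0\<^sub>v n" "?A *\<^sub>v v = 0\<^sub>v n"
    by (subst (asm) det_0_iff_vec_prod_zero_field[of _ n]) auto
  then obtain c where c: "c < n" "v $ c \<noteq> 0"
    by (metis carrier_vecD eq_vecI index_zero_vec)
  obtain a where a: "a < n" "\<And>b. b < n \<Longrightarrow> \<bar>v $ b\<bar> \<le> \<bar>v $ a\<bar>"
  proof -
    have "Max ((\<lambda>b. \<bar>v $ b\<bar>) ` {..<n}) \<in> (\<lambda>b. \<bar>v $ b\<bar>) ` {..<n}"
      using c by (intro Max_in) auto
    then obtain a where "a < n" "Max ((\<lambda>b. \<bar>v $ b\<bar>) ` {..<n}) = \<bar>v $ a\<bar>" by auto
    then show ?thesis using that Max_ge[of "(\<lambda>b. \<bar>v $ b\<bar>) ` {..<n}"] by auto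
  qed
  have pos: "\<bar>v $ a\<bar> > 0" using a(2)[OF c(1)] c(2) by simp
  have "0 = (?A *\<^sub>v v) $ a" using v a by simp
  also have "\<dots> = (\<Sum>b<n. ((if a = b then \<alpha> else 0) - E a b) * v $ b)"
    using a v(1) by (simp add: scalar_prod_def lessThan_atLeast0)
  also have "\<dots> = (\<Sum>b<n. (if a = b then \<alpha> * v $ b else 0) - E a b * v $ b)"
    by (intro sum.cong refl) (simp add: algebra_simps)
  also have "\<dots> = \<alpha> * v $ a - (\<Sum>b<n. E a b * v $ b)"
    using a(1) by (simp add: sum_subtractf)
  finally have "\<alpha> * \<bar>v $ a\<bar> \<le> \<bar>\<Sum>b<n. E a b * v $ b\<bar>"
    by (metis abs_ge_self abs_mult abs_ge_zero eq_iff_diff_eq_0 mult_right_mono)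
  also have "\<dots> \<le> (\<Sum>b<n. \<bar>E a b * v $ b\<bar>)"
    by (rule sum_abs)
  also have "\<dots> \<le> (\<Sum>b<n. E a b * \<bar>v $ a\<bar>)"
    using E a by (intro sum_mono) (auto simp: abs_mult intro!: mult_left_mono)
  also have "\<dots> < \<alpha> * \<bar>v $ a\<bar>"
    using row[OF a(1)] pos by (simp flip: sum_distrib_right)
  finally show False by simp
qed

lemma invertible_mat_if_det_nonzero:
  fixes A :: "real mat"
  assumes A: "A \<in> carrier_mat n n" and "det A \<noteq> 0"
  shows "invertible_mat A"
proof -
  have "A \<in> Units (ring_mat TYPE(real) n n)"
    using assms by (rule det_non_zero_imp_unit)
  then show ?thesis
    using A unfolding Units_def ring_mat_simps invertible_mat_def inverts_mat_def by auto
qed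

lemma smult_smult_mat: "a \<cdot>\<^sub>m (b \<cdot>\<^sub>m A) = (a * b :: real) \<cdot>\<^sub>m A"
  by (rule eq_matI) auto

lemma one_smult_mat: "(1 :: real) \<cdot>\<^sub>m A = A"
  by (rule eq_matI) auto

text \<open>For the difference \<open>C\<close>, the product \<open>B * C\<close> is the centring
  matrix \<open>1 - J / n\<close>. Since the rows of \<open>C\<close> sum to zero,
  \<open>C * J = 0\<close>, so multiplying by \<open>C\<close> on the left returns
  \<open>C\<close>.\<close>

lemma g_inverse_diff_J_mat:
  fixes A B :: "real mat"
  assumes A: "A \<in> carrier_mat n n" and B: "B \<in> carrier_mat n n" and BA: "B * A = 1\<^sub>m n"
    and row: "\<And>a. a < n \<Longrightarrow> (\<Sum>b<n. A $$ (a, b)) = \<mu>" and "\<mu> \<noteq> 0"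
  shows "g_inverse (A - (\<mu> / real n) \<cdot>\<^sub>m J_mat n) B"
proof -
  define J where "J = J_mat n"
  define C where "C = A - (\<mu> / real n) \<cdot>\<^sub>m J"
  have J: "J \<in> carrier_mat n n" by (auto simp: J_def)
  have C: "C \<in> carrier_mat n n" using A J by (auto simp: C_def)
  have AJ: "A * J = \<mu> \<cdot>\<^sub>m J"
    using A row by (intro eq_matI) (auto simp: J_def scalar_prod_def J_mat_index lessThan_atLeast0)
  have JJ: "J * J = real n \<cdot>\<^sub>m J"
    by (intro eq_matI) (auto simp: J_def scalar_prod_def J_mat_index)
  have "J = B * A * J" using J BA by simp
  also have "\<dots> = \<mu> \<cdot>\<^sub>m (B * J)"
    using A B J by (simp add: assoc_mult_mat[of B n n A n J n] AJ mult_smult_distrib)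
  finally have "(1 / \<mu>) \<cdot>\<^sub>m J = (1 / \<mu>) \<cdot>\<^sub>m (\<mu> \<cdot>\<^sub>m (B * J))" by simp
  then have BJ: "B * J = (1 / \<mu>) \<cdot>\<^sub>m J"
    using \<open>\<mu> \<noteq> 0\<close> by (simp add: smult_smult_mat one_smult_mat)
  have "B * C = 1\<^sub>m n - (1 / real n) \<cdot>\<^sub>m J"
    using A B J \<open>\<mu> \<noteq> 0\<close>
    by (simp add: C_def mult_minus_distrib_mat[of B n n A n] BA mult_smult_distrib BJ smult_smult_mat)
  moreover have "C * J = 0\<^sub>m n n"
    using A J
    by (simp add: C_def minus_mult_distrib_mat[of A n n _ J n] AJ mult_smult_assoc_mat[of J n n J n]
        JJ smult_smult_mat)
      (intro impI eq_matI, auto)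
  ultimately have "C * (B * C) = C"
    using C J mult_minus_distrib_mat[OF C one_carrier_mat, of "(1 / real n) \<cdot>\<^sub>m J"]
    by (simp add: mult_smult_distrib)
       (intro eq_matI, auto)
  then show ?thesis
    using B C assoc_mult_mat[OF C B C] unfolding g_inverse_def C_def J_def by auto
qed

theorem theorem4:
  fixes t g m :: nat and d_plan d_min :: design
  assumes "t \<ge> 4" and "g \<ge> 1" and "1 \<le> m" and "m < t - 1"
    and "UBRMD t g d_plan"
    and "d_min = first_periods (t - m) d_plan"
  shows
    "(\<forall>G. g_inverse (C22 d_min) G \<longrightarrow> C_D d_min = C11 d_min - C12 d_min * G * C21 d_min)
     \<and> (\<forall>G. g_inverse (C11 d_min) G \<longrightarrow> C_R d_min = C22 d_min - C21 d_min * G * C12 d_min)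
     \<and> C21 d_min = (C12 d_min)\<^sup>T
     \<and> C11 d_min =
         (real g * ((real t - real m)^2 - real m) / (real t - real m)) \<cdot>\<^sub>m 1\<^sub>m t
         - (real g * (real t - 2 * real m) / (real t - real m)) \<cdot>\<^sub>m J_mat t
         - (1 / (real t - real m)) \<cdot>\<^sub>m
             mat_sum t t (\<lambda>(j, k). U d_plan j k)
               {(j, k). j \<le> m - 1 \<and> k \<le> m - 1 \<and> j \<noteq> k}
     \<and> C22 d_min =
         (real g / (real t - real m)) \<cdot>\<^sub>m
           (((real t - real m)^2 - (real t + 1)) \<cdot>\<^sub>m 1\<^sub>m t
            - ((1 / real t) *
                ((real t - real m)^2 - (real t + 1) - real m * (real m + 1))) \<cdot>\<^sub>m J_mat t)
         - (1 / (real t - real m)) \<cdot>\<^sub>m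
             mat_sum t t (\<lambda>(j, k). U d_plan j k) {(j, k). j \<le> m \<and> k \<le> m \<and> j \<noteq> k}
     \<and> C12 d_min =
         (real g / (real t - real m)) \<cdot>\<^sub>m
           ((real m + 1) \<cdot>\<^sub>m J_mat t - real t \<cdot>\<^sub>m 1\<^sub>m t)
         - mat_sum t t (\<lambda>j. U d_plan j (j + 1)) {0..m - 1}
         - (1 / (real t - real m)) \<cdot>\<^sub>m
             mat_sum t t (\<lambda>j. mat_sum t t (\<lambda>k. U d_plan j k) {k. k \<le> m \<and> k \<noteq> j}) {0..m - 1}
     \<and> (t \<ge> 2 * m + 2 \<longrightarrow>
         (let A = (real g / (real t - real m) * ((real t - real m)^2 - (real t + 1))) \<cdot>\<^sub>m 1\<^sub>m t
                  - (1 / (real t - real m)) \<cdot>\<^sub>m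
                      mat_sum t t (\<lambda>(j, k). U d_plan j k) {(j, k). j \<le> m \<and> k \<le> m \<and> j \<noteq> k}
          in invertible_mat A \<and>
             (\<forall>B. inverts_mat A B \<and> inverts_mat B A \<longrightarrow> g_inverse (C22 d_min) B)))"
proof -
  interpret UBRMD_design t g d_plan
    using assms by unfold_locales auto
  note m = \<open>m < t - 1\<close>
  let ?D = "first_periods (t - m) d_plan"
  let ?p = "real t - real m"
  let ?q = "?p^2 - (real t + 1)"
  have pos: "subjects ?D > 0" "periods ?D > 0"
    using assms params_min[OF m] by auto
  let ?S = "mat_sum t t (\<lambda>(j, k). U d_plan j k) {(j, k). j \<le> m \<and> k \<le> m \<and> j \<noteq> k}"
  define A where "A = (real g / ?p * ?q) \<cdot>\<^sub>m 1\<^sub>m t - (1 / ?p) \<cdot>\<^sub>m ?S"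
  have A: "A \<in> carrier_mat t t"
    by (intro carrier_matI) (simp_all add: A_def mat_sum_def)
  define E where "E a b = u_offdiag (Suc m) (Suc m) a b / ?p" for a b
  have A_eq: "A = mat t t (\<lambda>(a, b). (if a = b then real g / ?p * ?q else 0) - E a b)"
    using m sum_U_offdiag[of m] by (intro eq_matI) (auto simp: A_def mat_sum_def E_def)
  have row_E: "(\<Sum>b<t. E a b) = real g / ?p * (real m * (real m + 1))" if "a < t" for a
    using that m u_offdiag_row_sum[of m a] by (simp add: E_def flip: sum_divide_distrib)
  \<comment> \<open>Row sums of \<open>A\<close>: the diagonal part contributes
    \<open>g / (t - m)\<close> times \<open>?q\<close>, and the \<open>U\<^sub>j\<^sub>k\<close>
    remove \<open>g / (t - m)\<close> times \<open>m * (m + 1)\<close>. The same number divided by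
    \<open>t\<close> is the coefficient of \<open>J\<close> in \<open>C22\<close>.\<close>
  define w where "w = ?q - real m * (real m + 1)"
  define \<mu> where "\<mu> = real g / ?p * w"
  have row_A: "(\<Sum>b<t. A $$ (a, b)) = \<mu>" if "a < t" for a
    using that row_E[OF that] by (simp add: A_eq sum_subtractf \<mu>_def w_def right_diff_distrib)
  have C22: "C22 ?D = A - (\<mu> / real t) \<cdot>\<^sub>m J_mat t"
    unfolding C22_formula[OF m] A_def \<mu>_def w_def[symmetric]
    by (intro eq_matI) (auto simp: mat_sum_def J_mat_index right_diff_distrib diff_divide_distrib)
  have inv: "invertible_mat A \<and> (\<forall>B. inverts_mat A B \<and> inverts_mat B A \<longrightarrow> g_inverse (C22 ?D) B)"
    if tm: "t \<ge> 2 * m + 2"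
  proof -
    \<comment> \<open>Expanding shows \<open>w = t * (t - 2 * m - 1) - (m + 1)\<close>, so
      \<open>t \<ge> 2 * m + 2\<close> gives \<open>w \<ge> t - (m + 1) > 0\<close>.\<close>
    have "real t * (real t - 2 * real m - 1) \<ge> real t * 1"
      using tm by (intro mult_left_mono) linarith+
    then have "?q - real m * (real m + 1) > 0"
      using tm by (simp add: power2_eq_square algebra_simps)
    then have mu: "\<mu> > 0"
      using assms(2) m by (simp add: \<mu>_def w_def)
    have "det A \<noteq> 0"
      unfolding A_eq
    proof (rule det_diagonally_dominant)
      show "0 \<le> E a b" for a b
        using m u_offdiag_nonneg by (simp add: E_def)
      \<comment> \<open>The gap between the two sides is exactly \<mu>.\<close>
      show "(\<Sum>b<t. E a b) < real g / ?p * ?q" if "a < t" for a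
        using mu row_E[OF that] by (simp add: \<mu>_def w_def right_diff_distrib)
    qed
    then have "invertible_mat A"
      by (rule invertible_mat_if_det_nonzero[OF A])
    moreover have "g_inverse (C22 ?D) B" if "inverts_mat A B" "inverts_mat B A" for B
    proof -
      have AB: "A * B = 1\<^sub>m t" and BA: "B * A = 1\<^sub>m (dim_row B)"
        using that A by (auto simp: inverts_mat_def)
      \<comment> \<open>\<open>inverts_mat\<close> leaves the dimensions of \<open>B\<close>
        implicit; comparing the numbers of columns in the two identities recovers them.\<close>
      have "dim_col B = t" "dim_row B = t"
        using arg_cong[OF AB, of dim_col] arg_cong[OF BA, of dim_col] A by auto
      then show ?thesis
        unfolding C22 using A BA row_A mu by (intro g_inverse_diff_J_mat) auto
    qed
    ultimately show ?thesis by blast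
  qed
  show ?thesis
    unfolding \<open>d_min = ?D\<close> Let_def
    using C_D_eq[OF pos] C_R_eq[OF pos] C21_def C11_formula[OF m assms(3)] C22_formula[OF m]
      C12_formula[OF m assms(3)] inv[unfolded A_def]
    by blast
qed

end
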